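(* Let $f:2^V\to\mathbb{Z}$ be a submodular function on a ground set $V$ with $|V|=n$, accessible through an evaluation oracle taking time $\mathrm{EO}$ per query. A minimizer of $f$ can be found using $O(n^3\log n)$ evaluation oracle calls (i.e. total oracle time $O(n^3\log n\cdot\mathrm{EO})$); no bound on the additional computation time is claimed.
   Context: $f$ is submodular if $f(T\cup\{i\})-f(T)\le f(S\cup\{i\})-f(S)$ for all $S\subseteq T\subseteq V$ and $i\in V\setminus T$. *)

theory Defs
  imports Complex_Main "HOL-Library.Landau_Symbols"
begin

definition submodular_on :: "'a set \<Rightarrow> ('a set \<Rightarrow> int) \<Rightarrow> bool" where
  "submodular_on V f \<longleftrightarrow>
     (\<forall>S T i. S \<subseteq> T \<and> T \<subseteq> V \<and> i \<in> V - T \<longrightarrow>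
        f (T \<union> {i}) - f T \<le> f (S \<union> {i}) - f S)"

text \<open>
  Deterministic adaptive algorithms with an evaluation oracle, as decision trees: such an
  algorithm either stops with an output set, or queries the oracle at a set and continues
  depending on the integer that is returned. Since only oracle calls are charged, the dependence
  of the continuation on the answer is an arbitrary function.
\<close>

datatype 'a eo_alg =
    Return "'a set"
  | Query "'a set" "int \<Rightarrow> 'a eo_alg"

text \<open>
  The oracle for a function on the subsets of \<open>V\<close> may be called on such subsets only,
  on every branch of the tree.
\<close>

primrec queries_within :: "'a set \<Rightarrow> 'a eo_alg \<Rightarrow> bool" where
  "queries_within V (Return X) \<longleftrightarrow> True"
| "queries_within V (Query S k) \<longleftrightarrow> S \<subseteq> V \<and> (\<forall>r. queries_within V (k r))"

primrec result :: "('a set \<Rightarrow> int) \<Rightarrow> 'a eo_alg \<Rightarrow> 'a set" where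
  "result f (Return X) = X"
| "result f (Query S k) = result f (k (f S))"

primrec oracle_calls :: "('a set \<Rightarrow> int) \<Rightarrow> 'a eo_alg \<Rightarrow> nat" where
  "oracle_calls f (Return X) = 0"
| "oracle_calls f (Query S k) = Suc (oracle_calls f (k (f S)))"

primrec oracle_time :: "real \<Rightarrow> ('a set \<Rightarrow> int) \<Rightarrow> 'a eo_alg \<Rightarrow> real" where
  "oracle_time EO f (Return X) = 0"
| "oracle_time EO f (Query S k) = EO + oracle_time EO f (k (f S))"

end

theory Submission
  imports Defs "HOL-Analysis.Finite_Function_Topology" "HOL-Analysis.Convex"
    "HOL-Real_Asymp.Real_Asymp"
begin

text \<open>
  Keep a family \<open>C\<close> of subsets of \<open>V\<close> that contains all minimizers unless a minimizer has already
  been queried. By the centerpoint theorem, a consequence of Helly's theorem, there is a point \<open>x\<close> of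
  the cube such that every open halfspace with \<open>x\<close> on its boundary contains at most a fraction
  \<open>n / (n + 1)\<close> of the indicator vectors of \<open>C\<close>. Querying the \<open>n + 1\<close> upper level sets of
  \<open>x\<close> (with ties broken) yields a subgradient \<open>g\<close> of the Lovasz extension at \<open>x\<close>. The value of that
  extension at \<open>x\<close> is an average of \<open>f\<close> over these level sets, so if none of them is a minimizer, then
  all minimizers lie in the open halfspace where \<open>g\<close> is smaller than at \<open>x\<close>. Since \<open>C\<close> starts with
  \<open>2 ^ n\<close> members, it is empty after \<open>(n + 1)\<^sup>2\<close> rounds, and the best queried set is a minimizer.
\<close>

section \<open>Centerpoints\<close>

text \<open>Translating one point of \<open>S\<close> to the origin leaves at least
  \<open>card B + 1\<close> differences in \<open>span B\<close>, too many to be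
  independent.\<close>

lemma affine_dependent_if_card_gt_span:
  fixes S :: "'v::real_vector set"
  assumes "finite S" "finite B" "S \<subseteq> span B" "card S \<ge> card B + 2"
  shows "affine_dependent S"
proof -
  obtain a where a: "a \<in> S"
    using assms(4) by fastforce
  let ?T = "(\<lambda>x. x - a) ` (S - {a})"
  have "?T \<subseteq> span B"
    using a assms(3) by (auto intro: span_diff)
  moreover have "card ?T = card S - 1"
    using a assms(1) by (simp add: card_image inj_on_def)
  ultimately have "dependent ?T"
    using independent_span_bound[OF assms(2), of ?T] assms(4) by fastforce
  moreover have "?T = {x - a |x. x \<in> S - {a}}"
    by auto
  ultimately have "affine_dependent (insert a (S - {a}))"
    by (intro dependent_imp_affine_dependent) auto
  then show ?thesis
    using a by (simp add: insert_absorb)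
qed

text \<open>Radon's proof of Helly's theorem, by induction on the index set. Since
  \<open>card B\<close> bounds the dimension of the span, the ambient space may be
  infinite-dimensional.\<close>

theorem Helly_span:
  fixes K :: "'i \<Rightarrow> 'v::real_vector set"
  assumes "finite B" "finite I"
    and "\<And>i. i \<in> I \<Longrightarrow> convex (K i)" "\<And>i. i \<in> I \<Longrightarrow> K i \<subseteq> span B"
    and "\<And>J. J \<subseteq> I \<Longrightarrow> card J \<le> card B + 1 \<Longrightarrow> \<exists>z. \<forall>i\<in>J. z \<in> K i"
  shows "\<exists>z. \<forall>i\<in>I. z \<in> K i"
  using assms(2-)
proof (induction I rule: finite_psubset_induct)
  case (psubset I)
  show ?case
  proof (cases "card I \<le> card B + 1")
    case True
    then show ?thesis
      using psubset.prems(3) by blast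
  next
    case False
    have "\<exists>z. \<forall>j\<in>I - {i}. z \<in> K j" if "i \<in> I" for i
    proof (rule psubset.IH)
      show "\<exists>z. \<forall>i\<in>J. z \<in> K i" if "J \<subseteq> I - {i}" "card J \<le> card B + 1" for J
        using psubset.prems(3)[of J] that by blast
    qed (use that psubset.prems in auto)
    \<comment> \<open>\<open>X i\<close> lies in every set of the family except possibly
      \<open>K i\<close>.\<close>
    then obtain X where X: "\<And>i j. i \<in> I \<Longrightarrow> j \<in> I \<Longrightarrow> j \<noteq> i \<Longrightarrow> X i \<in> K j"
      by (metis Diff_iff singletonD)
    show ?thesis
    proof (cases "inj_on X I")
      case False
      then obtain i j where "i \<in> I" "j \<in> I" "i \<noteq> j" "X i = X j"
        by (auto simp: inj_on_def)
      then have "\<forall>k\<in>I. X i \<in> K k"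
        using X by metis
      then show ?thesis ..
    next
      case True
      have "X i \<in> span B" if "i \<in> I" for i
      proof -
        have "\<not> I \<subseteq> {i}"
          using False card_mono[of "{i}" I] by auto
        then show ?thesis
          using X psubset.prems(2) that by blast
      qed
      then have "affine_dependent (X ` I)"
        using False True psubset.hyps assms(1)
        by (intro affine_dependent_if_card_gt_span[of _ B]) (auto simp: card_image)
      then obtain M P z where MP: "M \<inter> P = {}" "M \<union> P = X ` I"
        and z: "z \<in> convex hull M" "z \<in> convex hull P"
        using Radon_partition[of "X ` I"] psubset.hyps by blast
      have "z \<in> K i" if i: "i \<in> I" for i
      proof -
        \<comment> \<open>As \<open>M\<close> and \<open>P\<close> are disjoint, one of them avoids
          \<open>X i\<close>; its hull lies in \<open>K i\<close> and contains
          \<open>z\<close>.\<close>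
        have *: "convex hull N \<subseteq> K i" if "N \<subseteq> X ` I" "X i \<notin> N" for N
        proof (rule hull_minimal)
          show "N \<subseteq> K i"
            using that X i by blast
        qed (use psubset.prems(1) i in auto)
        show ?thesis
          using *[of M] *[of P] MP z by blast
      qed
      then show ?thesis
        by blast
    qed
  qed
qed

text \<open>Helly's theorem applies to the hulls of all large parts \<open>D\<close> of
  \<open>C\<close>: each part misses fewer than \<open>card C / (card B + 1)\<close> points, so
  \<open>card B + 1\<close> of them share a point of \<open>C\<close>. An open halfspace with
  \<open>z\<close> on its boundary contains no large part, as it would then contain its hull and
  hence \<open>z\<close>.\<close>

theorem centerpoint:
  fixes C :: "'v::real_vector set"
  assumes "finite B" "finite C" "C \<noteq> {}" "C \<subseteq> span B"
  obtains z where "z \<in> convex hull C"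
    and "\<And>\<phi> :: 'v \<Rightarrow> real. linear \<phi> \<Longrightarrow>
      (card B + 1) * card {c \<in> C. \<phi> c < \<phi> z} \<le> card B * card C"
proof -
  let ?n = "card B"
  define I where "I = {D. D \<subseteq> C \<and> ?n * card C < (?n + 1) * card D}"
  have "finite I"
    using assms(2) by (simp add: I_def)
  have "C \<in> I"
    using assms(2,3) by (simp add: I_def card_gt_0_iff)
  have "\<exists>z. \<forall>D\<in>I. z \<in> convex hull D"
  proof (rule Helly_span[OF assms(1) \<open>finite I\<close>])
    fix D assume "D \<in> I"
    then have "D \<subseteq> span B"
      using assms(4) by (auto simp: I_def)
    then show "convex hull D \<subseteq> span B"
      by (intro hull_minimal) (auto intro: subspace_imp_convex)
  next
    fix J assume J: "J \<subseteq> I" "card J \<le> ?n + 1"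
    have "\<exists>c\<in>C. \<forall>D\<in>J. c \<in> D"
    proof (rule ccontr)
      assume "\<not> ?thesis"
      then have "C \<subseteq> (\<Union>D\<in>J. C - D)"
        by blast
      then have "card C \<le> card (\<Union>D\<in>J. C - D)"
        using assms(2) J(1) \<open>finite I\<close> by (intro card_mono) (auto intro: finite_subset)
      also have "\<dots> \<le> (\<Sum>D\<in>J. card (C - D))"
        using J(1) \<open>finite I\<close> by (intro card_UN_le) (auto intro: finite_subset)
      finally have "(?n + 1) * card C \<le> (\<Sum>D\<in>J. (?n + 1) * card (C - D))"
        by (metis mult_le_mono2 sum_distrib_left)
      \<comment> \<open>Each term is an integer strictly below \<open>card C\<close>; with at most
        \<open>card B + 1\<close> terms the complements are too small to cover
        \<open>C\<close>.\<close>
      also have "\<dots> \<le> (\<Sum>D\<in>J. card C - 1)"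
      proof (rule sum_mono)
        fix D assume "D \<in> J"
        then have D: "D \<subseteq> C" "?n * card C < (?n + 1) * card D"
          using J(1) by (auto simp: I_def)
        have "card (C - D) + card D = card C"
          using D(1) assms(2) by (metis card_Diff_subset card_mono finite_subset le_add_diff_inverse2)
        then have "(?n + 1) * card (C - D) + (?n + 1) * card D = ?n * card C + card C"
          by (metis add.commute distrib_left mult.commute mult_Suc_right Suc_eq_plus1)
        then show "(?n + 1) * card (C - D) \<le> card C - 1"
          using D(2) by linarith
      qed
      also have "\<dots> \<le> (?n + 1) * (card C - 1)"
        using mult_le_mono1[OF J(2), of "card C - 1"] by simp
      finally have "card C \<le> card C - 1"
        by (simp del: mult_Suc)
      then show False
        using assms(2,3) by (metis card_gt_0_iff diff_less less_one not_le)
    qed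
    then show "\<exists>z. \<forall>D\<in>J. z \<in> convex hull D"
      by (meson hull_inc)
  qed auto
  then obtain z where z: "\<And>D. D \<in> I \<Longrightarrow> z \<in> convex hull D"
    by blast
  show ?thesis
  proof
    show "z \<in> convex hull C"
      using z \<open>C \<in> I\<close> .
    fix \<phi> :: "'v \<Rightarrow> real" assume lin: "linear \<phi>"
    show "(?n + 1) * card {c \<in> C. \<phi> c < \<phi> z} \<le> ?n * card C"
    proof (rule ccontr)
      assume "\<not> ?thesis"
      then have "z \<in> convex hull {c \<in> C. \<phi> c < \<phi> z}"
        by (intro z) (auto simp: I_def)
      moreover have "convex (\<phi> -` {..<\<phi> z})"
        by (intro convex_linear_vimage lin convex_real_interval)
      then have "convex hull {c \<in> C. \<phi> c < \<phi> z} \<subseteq> \<phi> -` {..<\<phi> z}"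
        by (intro hull_minimal) auto
      ultimately show False
        by auto
    qed
  qed
qed

text \<open>
  The finitely supported functions serve as one real vector space that contains the cubes of all
  finite dimensions.
\<close>

lemma lookup_scaleR_poly_mapping:
  "Poly_Mapping.lookup (c *\<^sub>R x) i = c *\<^sub>R Poly_Mapping.lookup x i"
proof -
  have "finite {i. c *\<^sub>R Poly_Mapping.lookup x i \<noteq> 0}"
    by (rule finite_subset[OF _ finite_lookup[of x]]) auto
  then show ?thesis
    by (simp add: scaleR_poly_mapping_def)
qed

text \<open>The indicator vectors \<open>chi S\<close> lie in the span of the \<open>card V\<close>
  unit vectors \<open>e i\<close>, and the linear functional with coefficients \<open>g\<close>
  takes the value \<open>sum g S\<close> at \<open>chi S\<close>.\<close>

lemma set_family_centerpoint:
  fixes V :: "'a set"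
  assumes "finite V" "C \<subseteq> Pow V"
  obtains x :: "'a \<Rightarrow> real" where "\<And>i. 0 \<le> x i" "\<And>i. x i \<le> 1"
    and "\<And>g. (card V + 1) * card {S \<in> C. sum g S < (\<Sum>i\<in>V. g i * x i)} \<le> card V * card C"
proof (cases "C = {}")
  case True
  then show ?thesis
    using that[of "\<lambda>_. 0"] by simp
next
  case False
  define e :: "'a \<Rightarrow> 'a \<Rightarrow>\<^sub>0 real" where "e i = Poly_Mapping.single i 1" for i
  define chi where "chi S = sum e S" for S
  have lookup_chi: "Poly_Mapping.lookup (chi S) i = (if i \<in> S then 1 else 0)" if "S \<subseteq> V" for S i
    using finite_subset[OF that assms(1)]
    by (simp add: chi_def e_def lookup_sum lookup_single when_def)
  have inj_e: "inj e"
    by (rule injI, unfold e_def) (metis lookup_single_eq lookup_single_not_eq zero_neq_one)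
  have inj_chi: "inj_on chi C"
  proof (rule inj_onI)
    fix S T assume "S \<in> C" "T \<in> C" "chi S = chi T"
    then have "i \<in> S \<longleftrightarrow> i \<in> T" for i
      using lookup_chi assms(2) by (metis PowD subsetD zero_neq_one)
    then show "S = T"
      by blast
  qed
  have card_e: "card (e ` V) = card V"
    using inj_e by (simp add: card_image inj_on_subset)
  have "chi S \<in> span (e ` V)" if "S \<subseteq> V" for S
    unfolding chi_def using that by (intro span_sum span_base) auto
  then have "chi ` C \<subseteq> span (e ` V)"
    using assms(2) by auto
  moreover have "finite (chi ` C)"
    using assms by (meson finite_Pow_iff finite_imageI finite_subset)
  moreover have "chi ` C \<noteq> {}"
    using False by simp
  ultimately obtain z where z: "z \<in> convex hull (chi ` C)"
    and half: "\<And>\<phi> :: ('a \<Rightarrow>\<^sub>0 real) \<Rightarrow> real. linear \<phi> \<Longrightarrow>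
      (card V + 1) * card {c \<in> chi ` C. \<phi> c < \<phi> z} \<le> card V * card C"
    using centerpoint[of "e ` V" "chi ` C"] assms(1)
    unfolding card_e card_image[OF inj_chi] by blast
  show ?thesis
  proof
    fix i
    have "linear (\<lambda>v :: 'a \<Rightarrow>\<^sub>0 real. Poly_Mapping.lookup v i)"
      by (intro linearI) (simp_all add: lookup_add lookup_scaleR_poly_mapping)
    then have "convex ((\<lambda>v :: 'a \<Rightarrow>\<^sub>0 real. Poly_Mapping.lookup v i) -` {0..1})"
      by (intro convex_linear_vimage convex_real_interval)
    then have "convex hull (chi ` C) \<subseteq> (\<lambda>v :: 'a \<Rightarrow>\<^sub>0 real. Poly_Mapping.lookup v i) -` {0..1}"
      using assms(2) by (intro hull_minimal) (auto simp: lookup_chi subset_iff)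
    then show "0 \<le> Poly_Mapping.lookup z i" "Poly_Mapping.lookup z i \<le> 1"
      using z by auto
  next
    fix g :: "'a \<Rightarrow> real"
    define \<phi> where "\<phi> v = (\<Sum>i\<in>V. g i * Poly_Mapping.lookup v i)" for v
    have "linear \<phi>"
      by (intro linearI)
        (simp_all add: \<phi>_def lookup_add lookup_scaleR_poly_mapping sum.distrib sum_distrib_left
          algebra_simps)
    have "\<phi> (chi S) = sum g S" if "S \<subseteq> V" for S
    proof -
      have "\<phi> (chi S) = (\<Sum>i\<in>V. if i \<in> S then g i else 0)"
        unfolding \<phi>_def by (intro sum.cong) (auto simp: lookup_chi[OF that])
      also have "\<dots> = sum g S"
        using that assms(1) by (simp add: sum.inter_restrict[symmetric] Int_absorb1)
      finally show ?thesis .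
    qed
    then have "{c \<in> chi ` C. \<phi> c < \<phi> z} = chi ` {S \<in> C. sum g S < \<phi> z}"
      using assms(2) by auto
    moreover have "inj_on chi {S \<in> C. sum g S < \<phi> z}"
      using inj_chi by (rule inj_on_subset) auto
    ultimately show "(card V + 1) * card {S \<in> C. sum g S < (\<Sum>i\<in>V. g i * Poly_Mapping.lookup z i)}
        \<le> card V * card C"
      using half[OF \<open>linear \<phi>\<close>] by (simp add: card_image \<phi>_def)
  qed
qed

section \<open>Subgradient cuts\<close>

text \<open>
  Summation by parts: the left-hand side is an average of the \<open>h k\<close> with weights \<open>1 - x 0\<close>,
  \<open>x (k - 1) - x k\<close> and \<open>x (n - 1)\<close>.
\<close>

lemma decreasing_weighted_increments_ge:
  fixes x h :: "nat \<Rightarrow> real"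
  assumes "\<And>k. k < n \<Longrightarrow> 0 \<le> x k" "\<And>k. k < n \<Longrightarrow> x k \<le> 1"
    and "\<And>k. Suc k < n \<Longrightarrow> x (Suc k) \<le> x k"
    and "\<And>k. k \<le> n \<Longrightarrow> m \<le> h k"
  shows "m \<le> h 0 + (\<Sum>k<n. x k * (h (Suc k) - h k))"
proof (cases n)
  case 0
  then show ?thesis
    using assms(4) by simp
next
  case (Suc n')
  \<comment> \<open>Of the total weight 1, \<open>x p\<close> still rests on
    \<open>h (Suc p)\<close>; the values carrying the rest have been replaced by
    \<open>m\<close>.\<close>
  have "x p * h (Suc p) + (1 - x p) * m \<le> h 0 + (\<Sum>k<Suc p. x k * (h (Suc k) - h k))"
    if "p < n" for p
    using that
  proof (induction p)
    case 0
    then have "(1 - x 0) * m \<le> (1 - x 0) * h 0"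
      using assms(2,4) by (intro mult_left_mono) auto
    then show ?case
      by (simp add: algebra_simps)
  next
    case (Suc p)
    then have "(x p - x (Suc p)) * m \<le> (x p - x (Suc p)) * h (Suc p)"
      using assms(3,4) by (intro mult_left_mono) auto
    then show ?case
      using Suc by (simp add: algebra_simps)
  qed
  from this[of n'] have "x n' * h n + (1 - x n') * m \<le> h 0 + (\<Sum>k<n. x k * (h (Suc k) - h k))"
    using Suc by simp
  moreover have "x n' * m \<le> x n' * h n"
    using assms(1,4) Suc by (intro mult_left_mono) auto
  ultimately show ?thesis
    by (simp add: algebra_simps)
qed

text \<open>Edmonds' greedy bound: at an element of \<open>S\<close>, passing from a prefix to its
  intersection with \<open>S\<close> can only raise the marginal gain, and the gains along these
  intersections telescope to \<open>f S - f {}\<close>.\<close>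

lemma submodular_greedy_le:
  assumes f: "submodular_on V f" and xs: "distinct xs" "set xs = V" and S: "S \<subseteq> V"
  shows "(\<Sum>k | k < length xs \<and> xs ! k \<in> S. f (set (take (Suc k) xs)) - f (set (take k xs)))
    \<le> f S - f {}"
proof -
  define h where "h k = f (set (take k xs))" for k
  have "(\<Sum>k<m. if xs ! k \<in> S then h (Suc k) - h k else 0) \<le> f (S \<inter> set (take m xs)) - f {}"
    if "m \<le> length xs" for m
    using that
  proof (induction m)
    case 0
    then show ?case
      by simp
  next
    case (Suc m)
    let ?T = "set (take m xs)" and ?i = "xs ! m"
    have T: "set (take (Suc m) xs) = ?T \<union> {?i}"
      using Suc.prems by (simp add: take_Suc_conv_app_nth)
    have "?i \<in> V - ?T"
      using xs Suc.prems by (auto simp: in_set_conv_nth[of _ "take m xs"] nth_eq_iff_index_eq)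
    moreover have "?T \<subseteq> V"
      using xs(2) set_take_subset by fast
    ultimately have "h (Suc m) - h m \<le> f (S \<inter> ?T \<union> {?i}) - f (S \<inter> ?T)"
      using f T unfolding submodular_on_def h_def by (metis inf_le2)
    moreover have "S \<inter> set (take (Suc m) xs) = (if ?i \<in> S then S \<inter> ?T \<union> {?i} else S \<inter> ?T)"
      unfolding T by auto
    ultimately show ?case
      using Suc by auto
  qed
  from this[of "length xs"] show ?thesis
    using S xs(2) unfolding h_def
    by (simp add: Int_absorb2 sum.If_cases Collect_conj_eq lessThan_def)
qed

text \<open>The order of quantifiers matters: \<open>Q\<close> is fixed before any answer is known,
  and \<open>g\<close> depends on \<open>f\<close> only through the answers \<open>r\<close>, so one
  cut serves every function consistent with them.\<close>

lemma chain_cut: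
  fixes V :: "'a set" and x :: "'a \<Rightarrow> real"
  assumes V: "finite V" and x: "\<And>i. 0 \<le> x i" "\<And>i. x i \<le> 1"
  obtains Q where "finite Q" "card Q \<le> card V + 1" "Q \<subseteq> Pow V"
    and "\<And>r. \<exists>g. \<forall>f S. submodular_on V f \<longrightarrow> (\<forall>T\<in>Q. f T = r T) \<longrightarrow>
           is_arg_min f (\<lambda>S. S \<subseteq> V) S \<longrightarrow> (\<forall>T\<in>Q. \<not> is_arg_min f (\<lambda>S. S \<subseteq> V) T) \<longrightarrow>
           sum g S < (\<Sum>i\<in>V. g i * x i)"
proof -
  obtain ys where ys: "set ys = V" "distinct ys"
    using finite_distinct_list[OF V] by blast
  \<comment> \<open>The prefixes of this order by decreasing \<open>x\<close> form a maximal chain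
    through the upper level sets of \<open>x\<close>.\<close>
  define xs where "xs = sort_key (\<lambda>i. - x i) ys"
  have xs: "distinct xs" "set xs = V" and n: "length xs = card V"
    using ys by (auto simp: xs_def distinct_card)
  have dec: "x (xs ! Suc k) \<le> x (xs ! k)" if "Suc k < length xs" for k
    using sorted_nth_mono[of "map (\<lambda>i. - x i) xs" k "Suc k"] that by (simp add: xs_def)
  have bij: "bij_betw ((!) xs) {..<length xs} V"
    using xs by (intro bij_betw_nth) auto
  define L where "L k = set (take k xs)" for k
  have L: "L k \<subseteq> V" for k
    using xs(2) set_take_subset by (fastforce simp: L_def)
  show ?thesis
  proof
    show "finite (L ` {..length xs})"
      by simp
    show "card (L ` {..length xs}) \<le> card V + 1"
      using card_image_le[of "{..length xs}" L] n by simp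
    show "L ` {..length xs} \<subseteq> Pow V"
      using L by auto
    fix r :: "'a set \<Rightarrow> int"
    define d where "d k = r (L (Suc k)) - r (L k)" for k
    define g :: "'a \<Rightarrow> real" where "g i = d (the_inv_into {..<length xs} ((!) xs) i)" for i
    have g: "g (xs ! k) = d k" if "k < length xs" for k
      using that bij by (simp add: g_def the_inv_into_f_f bij_betw_def)
    have "sum g S < (\<Sum>i\<in>V. g i * x i)"
      if f: "submodular_on V f" and r: "\<forall>T\<in>L ` {..length xs}. f T = r T"
        and S: "is_arg_min f (\<lambda>S. S \<subseteq> V) S"
        and no: "\<forall>T\<in>L ` {..length xs}. \<not> is_arg_min f (\<lambda>S. S \<subseteq> V) T" for f S
    proof -
      have SV: "S \<subseteq> V"
        using S by (simp add: is_arg_min_def)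
      have d: "d k = f (L (Suc k)) - f (L k)" if "k < length xs" for k
        using r that by (simp add: d_def)
      have "S = (!) xs ` {k. k < length xs \<and> xs ! k \<in> S}"
        using SV bij by (auto simp: bij_betw_def)
      then have "sum g S = sum g ((!) xs ` {k. k < length xs \<and> xs ! k \<in> S})"
        by simp
      also have "\<dots> = (\<Sum>k | k < length xs \<and> xs ! k \<in> S. g (xs ! k))"
        using bij by (subst sum.reindex) (auto simp: bij_betw_def intro: inj_on_subset)
      also have "\<dots> = (\<Sum>k | k < length xs \<and> xs ! k \<in> S. real_of_int (f (L (Suc k)) - f (L k)))"
        by (intro sum.cong) (simp_all add: g d)
      also have "\<dots> \<le> real_of_int (f S - f {})"
        using submodular_greedy_le[OF f xs SV] unfolding L_def of_int_sum[symmetric] of_int_le_iff .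
      finally have lower: "sum g S \<le> real_of_int (f S) - f {}"
        by simp
      have less: "f S < f (L k)" if "k \<le> length xs" for k
      proof (rule ccontr)
        assume "\<not> f S < f (L k)"
        then have "is_arg_min f (\<lambda>S. S \<subseteq> V) (L k)"
          using S L[of k] unfolding is_arg_min_linorder by (meson not_less order_trans)
        then show False
          using no that by blast
      qed
      \<comment> \<open>Integrality turns \<open>f S < f (L k)\<close> into a gap of 1. Since
        \<open>L 0\<close> is empty, combining with \<open>lower\<close> cancels \<open>f {}\<close>
        and leaves a strict inequality.\<close>
      have "real_of_int (f S) + 1 \<le> f (L 0)
          + (\<Sum>k<length xs. x (xs ! k) * (real_of_int (f (L (Suc k))) - f (L k)))"
      proof (rule decreasing_weighted_increments_ge)
        show "real_of_int (f S) + 1 \<le> f (L k)" if "k \<le> length xs" for k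
          using less[OF that] by linarith
      qed (use x dec in auto)
      also have "(\<Sum>k<length xs. x (xs ! k) * (real_of_int (f (L (Suc k))) - f (L k)))
          = (\<Sum>k<length xs. g (xs ! k) * x (xs ! k))"
        by (intro sum.cong) (simp_all add: g d)
      also have "\<dots> = (\<Sum>i\<in>V. g i * x i)"
        by (rule sum.reindex_bij_betw[OF bij])
      finally show ?thesis
        using lower by (simp add: L_def)
    qed
    then show "\<exists>g. \<forall>f S. submodular_on V f \<longrightarrow> (\<forall>T\<in>L ` {..length xs}. f T = r T) \<longrightarrow>
        is_arg_min f (\<lambda>S. S \<subseteq> V) S \<longrightarrow>
        (\<forall>T\<in>L ` {..length xs}. \<not> is_arg_min f (\<lambda>S. S \<subseteq> V) T) \<longrightarrow>
        sum g S < (\<Sum>i\<in>V. g i * x i)"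
      by blast
  qed
qed

section \<open>Query complexity\<close>

text \<open>In use, \<open>F\<close> holds the functions consistent with the answers so far; a
  single tree must serve them all.\<close>

definition minimizable_within :: "'a set \<Rightarrow> ('a set \<Rightarrow> int) set \<Rightarrow> nat \<Rightarrow> bool" where
  "minimizable_within V F t \<longleftrightarrow> (\<exists>A. queries_within V A \<and>
     (\<forall>f\<in>F. is_arg_min f (\<lambda>S. S \<subseteq> V) (result f A) \<and> oracle_calls f A \<le> t))"

lemma minimizable_within_mono:
  "minimizable_within V F s \<Longrightarrow> s \<le> t \<Longrightarrow> minimizable_within V F t"
  unfolding minimizable_within_def by (meson le_trans)

lemma minimizable_within_query:
  assumes "S \<subseteq> V" "\<And>v. minimizable_within V {f \<in> F. f S = v} t"
  shows "minimizable_within V F (Suc t)"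
proof -
  have "\<forall>v. \<exists>A. queries_within V A \<and> (\<forall>f\<in>{f \<in> F. f S = v}.
      is_arg_min f (\<lambda>S. S \<subseteq> V) (result f A) \<and> oracle_calls f A \<le> t)"
    using assms(2) unfolding minimizable_within_def by blast
  from choice[OF this] obtain A where "\<forall>v. queries_within V (A v) \<and> (\<forall>f\<in>{f \<in> F. f S = v}.
      is_arg_min f (\<lambda>S. S \<subseteq> V) (result f (A v)) \<and> oracle_calls f (A v) \<le> t)" ..
  then show ?thesis
    unfolding minimizable_within_def using assms(1) by (intro exI[of _ "Query S A"]) auto
qed

text \<open>A batch of queries chosen in advance: \<open>r\<close> ranges over all possible tables
  of answers, and each table may have its own continuation.\<close>

lemma minimizable_within_queries:
  assumes "finite Q" "Q \<subseteq> Pow V"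
    and "\<And>r. minimizable_within V {f \<in> F. \<forall>S\<in>Q. f S = r S} t"
  shows "minimizable_within V F (t + card Q)"
  using assms
proof (induction Q arbitrary: F rule: finite_induct)
  case empty
  then show ?case
    by simp
next
  case (insert S Q)
  have "minimizable_within V F (Suc (t + card Q))"
  proof (rule minimizable_within_query)
    fix v
    show "minimizable_within V {f \<in> F. f S = v} (t + card Q)"
    proof (rule insert.IH)
      fix r
      have "{f \<in> {f \<in> F. f S = v}. \<forall>T\<in>Q. f T = r T}
          = {f \<in> F. \<forall>T\<in>insert S Q. f T = (r(S := v)) T}"
        using insert.hyps(2) by auto
      then show "minimizable_within V {f \<in> {f \<in> F. f S = v}. \<forall>T\<in>Q. f T = r T} t"
        using insert.prems(2)[of "r(S := v)"] by (simp only:)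
    qed (use insert.prems in auto)
  qed (use insert.prems in auto)
  then show ?case
    using insert.hyps by simp
qed

text \<open>\<open>Q\<close> holds sets already queried, whose values are common to all of
  \<open>F\<close>, and \<open>C\<close> the remaining candidates. A round of at most
  \<open>card V + 1\<close> queries shrinks \<open>C\<close> at least by the factor
  \<open>card V / (card V + 1)\<close>. The last hypothesis is the potential that \<open>t\<close>
  such rounds use up; at \<open>t = 0\<close> it forces \<open>C\<close> to be empty.\<close>

lemma minimizable_within_candidates:
  fixes V :: "'a set"
  assumes V: "finite V" and "\<And>f. f \<in> F \<Longrightarrow> submodular_on V f"
    and "finite Q" "Q \<subseteq> Pow V" "\<And>f f' S. f \<in> F \<Longrightarrow> f' \<in> F \<Longrightarrow> S \<in> Q \<Longrightarrow> f S = f' S"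
    and "C \<subseteq> Pow V"
    and "\<And>f S. f \<in> F \<Longrightarrow> is_arg_min f (\<lambda>S. S \<subseteq> V) S \<Longrightarrow>
           S \<in> C \<or> (\<exists>T\<in>Q. is_arg_min f (\<lambda>S. S \<subseteq> V) T)"
    and "card C * card V ^ t < (card V + 1) ^ t"
  shows "minimizable_within V F (t * (card V + 1))"
  using assms(2-)
proof (induction t arbitrary: F Q C)
  case 0
  have "finite C"
    using V 0(5) by (simp add: finite_subset)
  with 0 have "C = {}"
    by simp
  show ?case
  proof (cases "F = {}")
    case True
    then show ?thesis
      unfolding minimizable_within_def by (intro exI[of _ "Return {}"]) simp
  next
    case False
    \<comment> \<open>All members of \<open>F\<close> agree on \<open>Q\<close>, so any one of them
      identifies the best queried set without further calls.\<close>
    then obtain f0 where f0: "f0 \<in> F"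
      by blast
    have ex: "\<exists>T\<in>Q. is_arg_min f (\<lambda>S. S \<subseteq> V) T" if "f \<in> F" for f
    proof -
      have "\<exists>S. is_arg_min f (\<lambda>S. S \<subseteq> V) S"
        using ex_is_arg_min_if_finite[of "Pow V" f] V by auto
      then show ?thesis
        using 0(6) \<open>C = {}\<close> that by blast
    qed
    then obtain S where S: "S \<in> Q" "\<And>T. T \<in> Q \<Longrightarrow> f0 S \<le> f0 T"
      using ex_is_arg_min_if_finite[OF 0(2), of f0] f0 
      by (metis empty_iff is_arg_min_linorder)
    have "is_arg_min f (\<lambda>S. S \<subseteq> V) S" if f: "f \<in> F" for f
    proof -
      obtain T where T: "T \<in> Q" "is_arg_min f (\<lambda>S. S \<subseteq> V) T"
        using ex f by blast
      then have "f S \<le> f T"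
        using S 0(4)[OF f f0] by simp
      then show ?thesis
        using T(2) S(1) 0(3) unfolding is_arg_min_linorder by (meson PowD order_trans subsetD)
    qed
    then show ?thesis
      unfolding minimizable_within_def by (intro exI[of _ "Return S"]) simp
  qed
next
  case (Suc t)
  obtain x :: "'a \<Rightarrow> real" where x: "\<And>i. 0 \<le> x i" "\<And>i. x i \<le> 1"
    and center: "\<And>g. (card V + 1) * card {S \<in> C. sum g S < (\<Sum>i\<in>V. g i * x i)} \<le> card V * card C"
    using set_family_centerpoint[OF V Suc.prems(5)] by blast
  obtain P where P: "finite P" "card P \<le> card V + 1" "P \<subseteq> Pow V"
    and cut: "\<And>r. \<exists>g. \<forall>f S. submodular_on V f \<longrightarrow> (\<forall>T\<in>P. f T = r T) \<longrightarrow>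
           is_arg_min f (\<lambda>S. S \<subseteq> V) S \<longrightarrow> (\<forall>T\<in>P. \<not> is_arg_min f (\<lambda>S. S \<subseteq> V) T) \<longrightarrow>
           sum g S < (\<Sum>i\<in>V. g i * x i)"
    using chain_cut[where V = V and x = x, OF V x] by blast
  have "minimizable_within V F (t * (card V + 1) + card P)"
  proof (rule minimizable_within_queries[OF P(1,3)])
    fix r
    obtain g where g: "\<And>f S. submodular_on V f \<Longrightarrow> \<forall>T\<in>P. f T = r T \<Longrightarrow>
        is_arg_min f (\<lambda>S. S \<subseteq> V) S \<Longrightarrow> \<forall>T\<in>P. \<not> is_arg_min f (\<lambda>S. S \<subseteq> V) T \<Longrightarrow>
        sum g S < (\<Sum>i\<in>V. g i * x i)"
      using cut[of r] by blast
    let ?F = "{f \<in> F. \<forall>S\<in>P. f S = r S}" and ?C = "{S \<in> C. sum g S < (\<Sum>i\<in>V. g i * x i)}"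
    show "minimizable_within V ?F (t * (card V + 1))"
    proof (rule Suc.IH[where Q = "Q \<union> P" and C = ?C])
      show "f S = f' S" if "f \<in> ?F" "f' \<in> ?F" "S \<in> Q \<union> P" for f f' S
        using that Suc.prems(4) by auto
      show "S \<in> ?C \<or> (\<exists>T\<in>Q \<union> P. is_arg_min f (\<lambda>S. S \<subseteq> V) T)"
        if "f \<in> ?F" "is_arg_min f (\<lambda>S. S \<subseteq> V) S" for f S
        using that g[of f S] Suc.prems(1)[of f] Suc.prems(6)[of f S] by blast
      have "(card V + 1) * (card ?C * card V ^ t) \<le> card C * card V ^ Suc t"
        using mult_le_mono1[OF center[of g], of "card V ^ t"] by (simp only: ac_simps power_Suc)
      also have "\<dots> < (card V + 1) * (card V + 1) ^ t"
        using Suc.prems(7) by simp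
      finally show "card ?C * card V ^ t < (card V + 1) ^ t"
        by (simp only: mult_less_cancel1)
    qed (use Suc.prems P in auto)
  qed
  then show ?case
    using P(2) by (elim minimizable_within_mono) simp
qed

text \<open>For positive \<open>n\<close>, raising
  \<open>2 * n ^ (n + 1) \<le> (n + 1) ^ (n + 1)\<close> to the power \<open>n + 1\<close> gives the
  factor \<open>2 ^ (n + 1)\<close>; the spare 2 makes the inequality strict.\<close>

lemma two_power_mult_power_less:
  fixes n :: nat
  shows "2 ^ n * n ^ (n + 1)\<^sup>2 < (n + 1) ^ (n + 1)\<^sup>2"
proof (cases "n = 0")
  case False
  have "2 * n ^ (n + 1) \<le> (n + 1) ^ (n + 1)"
  proof -
    \<comment> \<open>These are the terms \<open>k = n + 1\<close> and \<open>k = n\<close> of the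
      binomial expansion; each is at least \<open>n ^ (n + 1)\<close>.\<close>
    have "n ^ (n + 1) + (n + 1) * n ^ n \<le> (n + 1) ^ (n + 1)"
      using sum_mono2[of "{..n + 1}" "{n, n + 1}" "\<lambda>k. (n + 1 choose k) * n ^ k"]
        binomial[of n 1 "n + 1"] by simp
    then show ?thesis
      by simp
  qed
  then have "(2 * n ^ (n + 1)) ^ (n + 1) \<le> ((n + 1) ^ (n + 1)) ^ (n + 1)"
    by (rule power_mono) simp
  then have "2 ^ (n + 1) * n ^ (n + 1)\<^sup>2 \<le> (n + 1) ^ (n + 1)\<^sup>2"
    by (simp only: power_mult_distrib power_mult[symmetric] power2_eq_square)
  moreover have "2 ^ n * n ^ (n + 1)\<^sup>2 < 2 ^ (n + 1) * n ^ (n + 1)\<^sup>2"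
    using False by simp
  ultimately show ?thesis
    by linarith
qed simp

text \<open>Initially nothing has been queried and every subset is a candidate; the cube is the
  number of rounds times the queries per round.\<close>

lemma minimizable_within_submodular:
  assumes "finite V"
  shows "minimizable_within V {f. submodular_on V f} ((card V + 1) ^ 3)"
proof -
  have "minimizable_within V {f. submodular_on V f} ((card V + 1)\<^sup>2 * (card V + 1))"
    using assms two_power_mult_power_less[of "card V"]
    by (intro minimizable_within_candidates[where Q = "{}" and C = "Pow V"])
      (auto simp: is_arg_min_def card_Pow)
  then show ?thesis
    by (simp add: power2_eq_square power3_eq_cube)
qed

lemma oracle_time_eq: "oracle_time EO f A = real (oracle_calls f A) * EO"
  by (induction A) (simp_all add: algebra_simps)

theorem mainTheorem12:
  shows "\<exists>(alg :: 'a set \<Rightarrow> 'a eo_alg) (q :: nat \<Rightarrow> nat).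
           (\<lambda>n. real (q n)) \<in> O(\<lambda>n. real n ^ 3 * ln (real n)) \<and>
           (\<forall>V. finite V \<longrightarrow>
              queries_within V (alg V) \<and>
              (\<forall>f. submodular_on V f \<longrightarrow>
                 is_arg_min f (\<lambda>S. S \<subseteq> V) (result f (alg V)) \<and>
                 oracle_calls f (alg V) \<le> q (card V) \<and>
                 (\<forall>EO\<ge>0. oracle_time EO f (alg V) \<le> real (q (card V)) * EO)))"
proof -
  obtain alg :: "'a set \<Rightarrow> 'a eo_alg" where alg: "\<And>V. finite V \<Longrightarrow> queries_within V (alg V) \<and>
      (\<forall>f. submodular_on V f \<longrightarrow> is_arg_min f (\<lambda>S. S \<subseteq> V) (result f (alg V)) \<and>
        oracle_calls f (alg V) \<le> (card V + 1) ^ 3)"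
    using minimizable_within_submodular unfolding minimizable_within_def mem_Collect_eq Ball_def
    by metis
  \<comment> \<open>The comparison is asymptotic, so \<open>ln 1 = 0\<close> does no harm.\<close>
  have "(\<lambda>n. real ((n + 1) ^ 3)) \<in> O(\<lambda>n. real n ^ 3 * ln (real n))"
    by real_asymp
  moreover have "oracle_time EO f (alg V) \<le> real ((card V + 1) ^ 3) * EO"
    if "finite V" "submodular_on V f" "EO \<ge> 0" for V f EO
    unfolding oracle_time_eq using alg that by (intro mult_right_mono) (simp_all only: of_nat_le_iff)
  ultimately show ?thesis
    using alg by (intro exI[of _ alg] exI[of _ "\<lambda>n. (n + 1) ^ 3"]) blast
qed

end
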